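(* Let $X$ be a random variable on an arbitrary measurable space and let $Y$ and $Z$ be real-valued random variables with conditional distribution functions $F_{Y|X}$ and $F_{Z|X}$ given $X$. Suppose that both $Y$ and $Z$ have continuous conditional distribution functions for every given value of $X$, i.e., $y\mapsto F_{Y|X}(y|x)$ and $z\mapsto F_{Z|X}(z|x)$ are continuous for every $x$. Let $U=F_{Y|X}(Y|X)$ and $V=F_{Z|X}(Z|X)$. If $Y$ and $Z$ are conditionally independent given $X$, then $U$ and $V$ are independent.
   Context: $F_{Y|X}(y|x)=P(Y\le y\mid X=x)$ and $F_{Z|X}(z|x)=P(Z\le z\mid X=x)$ denote the conditional distribution functions of $Y$ and $Z$ given $X=x$. The random variable $U=F_{Y|X}(Y|X)$ is obtained by evaluating $F_{Y|X}(y|x)$ at $(y,x)=(Y,X)$, and similarly for $V$. The joint distribution function of $(U,V)$ is called the partial copula pertaining to $Y$ and $Z$ given $X$. *)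

theory Defs
  imports "HOL-Probability.Probability"
begin

(* P(E | X), as the random variable E[1_E | sigma(X)] on the sample space (a version of it:
   it is determined only up to M-null sets).  The definition is meaningful for prob_space M,
   X \<in> measurable M N and E \<in> sets M. *)
definition cond_prob_given ::
    "'a measure \<Rightarrow> 'x measure \<Rightarrow> ('a \<Rightarrow> 'x) \<Rightarrow> 'a set \<Rightarrow> 'a \<Rightarrow> real" where
  "cond_prob_given M N X E =
     real_cond_exp M (vimage_algebra (space M) X N) (indicator E)"

(* F y x stands for F(y|x) = P(Y \<le> y | X = x).  Conditional probabilities given X = x are
   determined only up to null sets, so this is a predicate on F rather than a function of
   (M, X, Y): every section F(.|x) is a distribution function on the real line, and F(y|.) is,
   for every y, a measurable function with F(y|X) = P(Y \<le> y | X) almost surely. *)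
definition cond_cdf ::
    "'a measure \<Rightarrow> 'x measure \<Rightarrow> ('a \<Rightarrow> 'x) \<Rightarrow> ('a \<Rightarrow> real) \<Rightarrow> (real \<Rightarrow> 'x \<Rightarrow> real) \<Rightarrow> bool" where
  "cond_cdf M N X Y F \<longleftrightarrow>
     (\<forall>x\<in>space N. \<exists>\<mu>. real_distribution \<mu> \<and> (\<forall>y. F y x = cdf \<mu> y)) \<and>
     (\<forall>y. F y \<in> borel_measurable N) \<and>
     (\<forall>y. AE \<omega> in M. F y (X \<omega>) = cond_prob_given M N X {\<omega>' \<in> space M. Y \<omega>' \<le> y} \<omega>)"

definition cond_indep_var ::
    "'a measure \<Rightarrow> 'x measure \<Rightarrow> ('a \<Rightarrow> 'x) \<Rightarrow> 'b measure \<Rightarrow> ('a \<Rightarrow> 'b) \<Rightarrow>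
     'c measure \<Rightarrow> ('a \<Rightarrow> 'c) \<Rightarrow> bool" where
  "cond_indep_var M N X S Y T Z \<longleftrightarrow>
     (\<forall>A\<in>sets S. \<forall>B\<in>sets T. AE \<omega> in M.
        cond_prob_given M N X {\<omega>' \<in> space M. Y \<omega>' \<in> A \<and> Z \<omega>' \<in> B} \<omega> =
        cond_prob_given M N X {\<omega>' \<in> space M. Y \<omega>' \<in> A} \<omega> *
        cond_prob_given M N X {\<omega>' \<in> space M. Z \<omega>' \<in> B} \<omega>)"

end

theory Submission
  imports Defs
begin

text \<open>
  Conditionally on \<open>X = x\<close>, the pair \<open>(Y, Z)\<close> has the product law \<open>\<mu> x \<Otimes> \<nu> x\<close>, where \<open>\<mu> x\<close> and \<open>\<nu> x\<close>
  are the distributions with distribution functions \<open>FY \<cdot> x\<close> and \<open>FZ \<cdot> x\<close>. By the probability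
  integral transform, a continuous distribution function carries its own distribution to the
  uniform law on \<open>[0, 1]\<close>. So the conditional law of \<open>(U, V)\<close> given \<open>X = x\<close> is the uniform law on the
  unit square, for every \<open>x\<close>. A mixture of copies of one law is that law again; hence \<open>(U, V)\<close> is
  unconditionally uniform on the square, and \<open>U\<close> and \<open>V\<close> are independent. It is essential that the
  conditional law of \<open>(U, V)\<close> does not depend on \<open>x\<close>: conditional independence alone would not
  survive the mixing.

  The probability integral transform is \<open>distr_cdf_eq_uniform\<close>. The hypotheses speak of conditional
  probabilities of single events, each up to its own null set, whereas the argument conditions on
  \<open>X = x\<close>. The passage between the two is \<open>joint_law_eq_bind\<close>, which writes the law of \<open>(X, (Y, Z))\<close> as
  the mixture of the laws \<open>\<delta>\<^sub>x \<Otimes> (\<mu> x \<Otimes> \<nu> x)\<close> with \<open>x\<close> distributed like \<open>X\<close>. Keeping the coordinate \<open>X\<close> in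
  this law is what allows it to be pushed forward along \<open>(x, (y, z)) \<mapsto> (FY y x, FZ z x)\<close>, a map that
  depends on \<open>x\<close>.
\<close>

section \<open>The probability integral transform\<close>

lemma (in real_distribution) cdf_onto:
  assumes "continuous_on UNIV (cdf M)" "0 < t" "t < 1"
  shows "\<exists>y. cdf M y = t"
proof -
  have "eventually (\<lambda>y. cdf M y < t) at_bot"
    using order_tendstoD(2)[OF cdf_lim_at_bot] assms by blast
  then obtain a where a: "\<And>y. y \<le> a \<Longrightarrow> cdf M y < t"
    by (auto simp: eventually_at_bot_linorder)
  have "eventually (\<lambda>y. t < cdf M y) at_top"
    using order_tendstoD(1)[OF cdf_lim_at_top_prob] assms by blast
  then obtain b where b: "\<And>y. b \<le> y \<Longrightarrow> t < cdf M y"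
    by (auto simp: eventually_at_top_linorder)
  have "\<exists>y. min a b \<le> y \<and> y \<le> max a b \<and> cdf M y = t"
    using a[of "min a b"] b[of "max a b"] assms(1)
    by (intro IVT') (auto intro: continuous_on_subset)
  then show ?thesis by blast
qed

text \<open>
  The transform may be constant on intervals, but by monotonicity this costs no mass: for \<open>0 < u < 1\<close>
  the set \<open>{y. cdf M y \<le> u}\<close> contains \<open>{..y}\<close> for any \<open>y\<close> with \<open>cdf M y = u\<close>, and it is contained in \<open>{..y}\<close> whenever
  \<open>cdf M y > u\<close>. As every value in \<open>(0, 1)\<close> is attained, its probability is squeezed to \<open>u\<close>.
\<close>

lemma (in real_distribution) distr_cdf_eq_uniform:
  assumes cont: "continuous_on UNIV (cdf M)"
  shows "distr M borel (cdf M) = uniform_measure lborel {0..1}"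
proof (rule cdf_unique)
  have mono: "mono (cdf M)"
    by (simp add: mono_def cdf_nondecreasing)
  have [measurable]: "cdf M \<in> borel_measurable borel"
    by (rule borel_measurable_mono[OF mono])
  then show rd: "real_distribution (distr M borel (cdf M))"
    by (intro real_distribution_distr) simp
  have "prob_space (uniform_measure lborel {0..1::real})"
    by (rule prob_space_uniform_measure) auto
  then show "real_distribution (uniform_measure lborel {0..1})"
    by (simp add: real_distribution_def real_distribution_axioms_def)
  show "cdf (distr M borel (cdf M)) = cdf (uniform_measure lborel {0..1})"
  proof
    fix u :: real
    have "cdf (uniform_measure lborel {0..1}) u = measure lborel ({0..1} \<inter> {..u})"
      by (simp add: cdf_def)
    also have "{0..1} \<inter> {..u} = {0..min 1 u}"
      by auto
    also have "measure lborel {0..min 1 u} = max 0 (min 1 u)"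
      by (cases "0 \<le> u") auto
    finally have R: "cdf (uniform_measure lborel {0..1}) u = max 0 (min 1 u)" .
    have L: "cdf (distr M borel (cdf M)) u = prob {y. cdf M y \<le> u}"
      unfolding cdf_def2[of "distr M borel (cdf M)" u] by (simp add: measure_distr vimage_def)
    have meas: "{y. cdf M y \<le> u} \<in> events"
      by simp
    consider "u < 0" | "1 \<le> u" | "0 \<le> u" "u < 1" by linarith
    then have "prob {y. cdf M y \<le> u} = max 0 (min 1 u)"
    proof cases
      case 1
      then have "{y. cdf M y \<le> u} = {}"
        using cdf_nonneg by (auto simp: not_le intro: less_le_trans)
      with 1 show ?thesis by simp
    next
      case 2
      then have "{y. cdf M y \<le> u} = space M"
        using cdf_bounded_prob by (auto intro: order_trans)
      with 2 show ?thesis by (simp only: prob_space)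
    next
      case 3
      have "u \<le> prob {y. cdf M y \<le> u}"
      proof (cases "u = 0")
        case False
        then obtain y where y: "cdf M y = u"
          using cdf_onto[OF cont, of u] 3 by auto
        have "prob {..y} \<le> prob {y. cdf M y \<le> u}"
          using meas y cdf_nondecreasing by (intro finite_measure_mono) auto
        then show ?thesis using y by (simp add: cdf_def)
      qed simp
      moreover have "prob {y. cdf M y \<le> u} \<le> u"
      proof (rule dense_ge_bounded[OF \<open>u < 1\<close>])
        fix t assume t: "u < t" "t < 1"
        then obtain y where y: "cdf M y = t"
          using cdf_onto[OF cont, of t] 3 by auto
        have "x \<le> y" if "cdf M x \<le> u" for x
          using that y t cdf_nondecreasing[of y x] by linarith
        then have "prob {y. cdf M y \<le> u} \<le> prob {..y}"
          by (intro finite_measure_mono) auto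
        then show "prob {y. cdf M y \<le> u} \<le> t" using y by (simp add: cdf_def)
      qed
      ultimately show ?thesis using 3 by simp
    qed
    with L R show "cdf (distr M borel (cdf M)) u = cdf (uniform_measure lborel {0..1}) u"
      by simp
  qed
qed

section \<open>The joint law as a mixture of product laws\<close>

lemma cond_cdf_kernelE:
  assumes "cond_cdf M N X Y F"
  obtains \<mu> where "\<mu> \<in> N \<rightarrow>\<^sub>M prob_algebra borel"
    and "\<And>x. x \<in> space N \<Longrightarrow> real_distribution (\<mu> x)"
    and "\<And>x y. x \<in> space N \<Longrightarrow> F y x = cdf (\<mu> x) y"
proof -
  from assms obtain \<mu> where rd: "\<And>x. x \<in> space N \<Longrightarrow> real_distribution (\<mu> x)"
    and F: "\<And>x y. x \<in> space N \<Longrightarrow> F y x = cdf (\<mu> x) y"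
    and Fm[measurable]: "\<And>y. F y \<in> borel_measurable N"
    unfolding cond_cdf_def by metis
  have "\<mu> \<in> N \<rightarrow>\<^sub>M prob_algebra borel"
  proof (rule measurable_prob_algebra_generated)
    show "sets (borel :: real measure) = sigma_sets UNIV (range atMost)"
      by (subst borel_eq_atMost) (auto intro!: sets_measure_of)
    show "Int_stable (range (atMost :: real \<Rightarrow> _))"
      by (auto simp: Int_stable_def)
    show "prob_space (\<mu> x)" "sets (\<mu> x) = sets borel" if "x \<in> space N" for x
      using rd[OF that] by (auto simp: real_distribution_def real_distribution_axioms_def)
    fix A :: "real set" assume "A \<in> range atMost"
    then obtain y where A: "A = {..y}" by auto
    have "emeasure (\<mu> x) A = ennreal (F y x)" if "x \<in> space N" for x
    proof -
      interpret real_distribution "\<mu> x" using rd[OF that] .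
      show ?thesis using F[OF that] A by (simp add: cdf_def emeasure_eq_measure)
    qed
    then show "(\<lambda>x. emeasure (\<mu> x) A) \<in> borel_measurable N"
      by (simp cong: measurable_cong)
  qed auto
  with rd F that show ?thesis by blast
qed


text \<open>
  The defining property of conditional expectation, with the sets of the \<open>\<sigma>\<close>-algebra generated by \<open>X\<close>
  written as preimages.
\<close>

lemma (in prob_space) prob_Int_eq_integral_cond_prob:
  assumes X: "X \<in> M \<rightarrow>\<^sub>M N" and A: "A \<in> sets N" and E: "E \<in> events"
  shows "prob ((X -` A \<inter> space M) \<inter> E)
    = (\<integral>\<omega>. indicator A (X \<omega>) * cond_prob_given M N X E \<omega> \<partial>M)"
proof -
  let ?G = "vimage_algebra (space M) X N"
  have "subalgebra M ?G"
    using X by (auto simp: subalgebra_def sets_vimage_algebra2 measurable_space measurable_sets)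
  then interpret finite_measure_subalgebra M ?G
    by unfold_locales
  let ?B = "X -` A \<inter> space M"
  have B: "?B \<in> events" using X A by (rule measurable_sets)
  have "prob (?B \<inter> E) = (\<integral>\<omega>\<in>?B. indicator E \<omega> \<partial>M)"
    using B E by (simp add: set_lebesgue_integral_def Int_ac flip: indicator_inter_arith)
  also have "\<dots> = (\<integral>\<omega>\<in>?B. cond_prob_given M N X E \<omega> \<partial>M)"
    unfolding cond_prob_given_def using E in_vimage_algebra[OF A]
    by (intro real_cond_exp_intA) (auto simp: emeasure_eq_measure)
  also have "\<dots> = (\<integral>\<omega>. indicator A (X \<omega>) * cond_prob_given M N X E \<omega> \<partial>M)"
    unfolding set_lebesgue_integral_def
    by (intro Bochner_Integration.integral_cong) (auto simp: indicator_def)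
  finally show ?thesis .
qed

text \<open>
  The order on pairs of reals is componentwise, so \<open>{..(y, z)}\<close> is the quadrant \<open>{..y} \<times> {..z}\<close>.
\<close>

lemma sets_pair_borel_borel_eq_atMost:
  "sets (N \<Otimes>\<^sub>M (borel :: (real \<times> real) measure))
    = sigma_sets (space N \<times> UNIV) {A \<times> {..p} | A p. A \<in> sets N}"
proof -
  let ?E = "range (atMost :: real \<times> real \<Rightarrow> _)"
  have "sets (N \<Otimes>\<^sub>M (borel :: (real \<times> real) measure)) = 
      sets (sigma (space N \<times> space borel) {a \<times> b | a b. a \<in> sets N \<and> b \<in> ?E})"
  proof (rule sets_pair_eq)
    show "sets (borel :: (real \<times> real) measure) = sigma_sets (space borel) ?E"
      by (subst borel_eq_atMost) (auto intro!: sets_measure_of)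
    show "countable {space N}" "{space N} \<subseteq> sets N" "\<Union>{space N} = space N"
      by auto
    have "\<exists>n. y \<le> real n \<and> z \<le> real n" for y z :: real
      using real_arch_simple[of "max y z"] by auto
    then show "\<Union>(range (\<lambda>n. {..(real n, real n)})) = space (borel :: (real \<times> real) measure)"
      by (auto simp: less_eq_prod_def)
  qed (auto simp: sets.space_closed sets.sigma_sets_eq)
  also have "{a \<times> b | a b. a \<in> sets N \<and> b \<in> ?E} = {A \<times> {..p} | A p. A \<in> sets N}"
    by blast
  finally show ?thesis
    using sets.sets_into_space by (subst (asm) sets_measure_of) fastforce+
qed

text \<open>
  The Markov kernel that keeps \<open>X \<omega>\<close> and draws the other two coordinates independently from
  \<open>\<mu> (X \<omega>)\<close> and \<open>\<nu> (X \<omega>)\<close>.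
\<close>

lemma measurable_product_kernel:
  fixes \<mu> \<nu> :: "'b \<Rightarrow> real measure"
  assumes [measurable]: "X \<in> M \<rightarrow>\<^sub>M N"
    "\<mu> \<in> N \<rightarrow>\<^sub>M subprob_algebra borel" "\<nu> \<in> N \<rightarrow>\<^sub>M subprob_algebra borel"
  shows "(\<lambda>\<omega>. distr (\<mu> (X \<omega>) \<Otimes>\<^sub>M \<nu> (X \<omega>)) (N \<Otimes>\<^sub>M borel) (Pair (X \<omega>)))
    \<in> M \<rightarrow>\<^sub>M subprob_algebra (N \<Otimes>\<^sub>M borel)"
  unfolding borel_prod[symmetric]
  by (intro measurable_distr2[where M="borel \<Otimes>\<^sub>M borel"] measurable_pair_measure) measurable

text \<open>
  Both sides agree on the boxes \<open>A \<times> {..(y, z)}\<close>, which form an intersection-stable generator. On such a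
  box, only the conditional probabilities of \<open>Y \<le> y\<close>, of \<open>Z \<le> z\<close> and of both occur, so that
  three almost sure equations suffice and uncountably many null sets never have to be
  combined.
\<close>

lemma (in prob_space) joint_law_eq_bind:
  assumes X[measurable]: "X \<in> M \<rightarrow>\<^sub>M N"
    and Y[measurable]: "Y \<in> borel_measurable M" and Z[measurable]: "Z \<in> borel_measurable M"
    and FY: "cond_cdf M N X Y FY" and FZ: "cond_cdf M N X Z FZ"
    and indep: "cond_indep_var M N X borel Y borel Z"
    and \<mu>[measurable]: "\<mu> \<in> N \<rightarrow>\<^sub>M prob_algebra borel"
    and \<mu>_cdf: "\<And>x y. x \<in> space N \<Longrightarrow> FY y x = cdf (\<mu> x) y"
    and \<nu>[measurable]: "\<nu> \<in> N \<rightarrow>\<^sub>M prob_algebra borel"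
    and \<nu>_cdf: "\<And>x z. x \<in> space N \<Longrightarrow> FZ z x = cdf (\<nu> x) z"
  shows "distr M (N \<Otimes>\<^sub>M borel) (\<lambda>\<omega>. (X \<omega>, (Y \<omega>, Z \<omega>)))
    = M \<bind> (\<lambda>\<omega>. distr (\<mu> (X \<omega>) \<Otimes>\<^sub>M \<nu> (X \<omega>)) (N \<Otimes>\<^sub>M borel) (Pair (X \<omega>)))"
    (is "?L = M \<bind> ?K")
proof -
  have [measurable]: "\<mu> \<in> N \<rightarrow>\<^sub>M subprob_algebra borel" "\<nu> \<in> N \<rightarrow>\<^sub>M subprob_algebra borel"
    using \<mu> \<nu> by (auto intro: measurable_prob_algebraD)
  have [measurable]: "FY y \<in> borel_measurable N" "FZ y \<in> borel_measurable N" for y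
    using FY FZ by (auto simp: cond_cdf_def)
  have K: "?K \<in> M \<rightarrow>\<^sub>M subprob_algebra (N \<Otimes>\<^sub>M borel)"
    by (rule measurable_product_kernel) measurable
  let ?E = "{A \<times> {..p} | A p. A \<in> sets N} :: ('b \<times> real \<times> real) set set"
  show ?thesis
  proof (rule measure_eqI_generator_eq[where E="?E" and \<Omega>="space N \<times> UNIV"])
    show "Int_stable ?E"
    proof (rule Int_stableI)
      fix a b assume "a \<in> ?E" "b \<in> ?E"
      then obtain A p B q where *: "A \<in> sets N" "B \<in> sets N" "a = A \<times> {..p}" "b = B \<times> {..q}"
        by blast
      then have "a \<inter> b = (A \<inter> B) \<times> {..inf p q}" by auto
      with * show "a \<inter> b \<in> ?E" by blast
    qed
    show "?E \<subseteq> Pow (space N \<times> UNIV)"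
      using sets.sets_into_space by fastforce
    show "sets ?L = sigma_sets (space N \<times> UNIV) ?E"
      by (simp add: sets_pair_borel_borel_eq_atMost)
    show "sets (M \<bind> ?K) = sigma_sets (space N \<times> UNIV) ?E"
      by (subst sets_bind[where N="N \<Otimes>\<^sub>M borel"])
        (simp_all add: sets_pair_borel_borel_eq_atMost not_empty)
    show "range (\<lambda>n. space N \<times> {..(real n, real n)}) \<subseteq> ?E"
      by auto
    have "\<exists>n. y \<le> real n \<and> z \<le> real n" for y z :: real
      using real_arch_simple[of "max y z"] by auto
    then show "(\<Union>n. space N \<times> {..(real n, real n)}) = space N \<times> UNIV"
      by (auto simp: less_eq_prod_def)
    have "prob_space ?L" by (rule prob_space_distr) measurable
    then show "emeasure ?L (space N \<times> {..(real n, real n)}) \<noteq> \<infinity>" for n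
      using finite_measure.emeasure_finite[OF prob_space.axioms(1)] by (simp only: infinity_ennreal_def)
    fix S assume "S \<in> ?E"
    then obtain A y z where A[measurable]: "A \<in> sets N" and "S = A \<times> {..(y, z)}"
      by auto
    then have S: "S = A \<times> ({..y} \<times> {..z})" by auto
    let ?Ey = "{\<omega> \<in> space M. Y \<omega> \<le> y}" and ?Ez = "{\<omega> \<in> space M. Z \<omega> \<le> z}"
    let ?Eyz = "{\<omega> \<in> space M. Y \<omega> \<le> y \<and> Z \<omega> \<le> z}"
    have cdf01: "0 \<le> FY y x" "FY y x \<le> 1" "0 \<le> FZ z x" "FZ z x \<le> 1"
      and FY_\<mu>: "emeasure (\<mu> x) {..y} = ennreal (FY y x)" 
      and FZ_\<nu>: "emeasure (\<nu> x) {..z} = ennreal (FZ z x)" if x: "x \<in> space N" for x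
    proof -
      interpret a: prob_space "\<mu> x" 
        using measurable_space[OF \<mu> x] by (simp add: space_prob_algebra)
      interpret b: prob_space "\<nu> x"
        using measurable_space[OF \<nu> x] by (simp add: space_prob_algebra)
      show "0 \<le> FY y x" "FY y x \<le> 1" "0 \<le> FZ z x" "FZ z x \<le> 1"
        "emeasure (\<mu> x) {..y} = ennreal (FY y x)" "emeasure (\<nu> x) {..z} = ennreal (FZ z x)"
        using x by (simp_all add: \<mu>_cdf \<nu>_cdf cdf_def a.emeasure_eq_measure b.emeasure_eq_measure)
    qed
    have "AE \<omega> in M. cond_prob_given M N X ?Eyz \<omega> =
        cond_prob_given M N X ?Ey \<omega> * cond_prob_given M N X ?Ez \<omega>"
      using indep[unfolded cond_indep_var_def, rule_format, of "{..y}" "{..z}"] by simp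
    moreover have "AE \<omega> in M. FY y (X \<omega>) = cond_prob_given M N X ?Ey \<omega>"
      "AE \<omega> in M. FZ z (X \<omega>) = cond_prob_given M N X ?Ez \<omega>"
      using FY FZ by (auto simp: cond_cdf_def)
    ultimately have ae: "AE \<omega> in M. indicator A (X \<omega>) * cond_prob_given M N X ?Eyz \<omega>
        = indicator A (X \<omega>) * (FY y (X \<omega>) * FZ z (X \<omega>))"
      by eventually_elim simp
    have [measurable]: "cond_prob_given M N X ?Eyz \<in> borel_measurable M"
      unfolding cond_prob_given_def by measurable
    have "emeasure ?L S = prob ((X -` A \<inter> space M) \<inter> ?Eyz)"
      unfolding S using A
      by (subst emeasure_distr)
        (auto simp: emeasure_eq_measure simp flip: borel_prod intro!: arg_cong[where f=prob])
    also have "prob ((X -` A \<inter> space M) \<inter> ?Eyz)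
        = (\<integral>\<omega>. indicator A (X \<omega>) * (FY y (X \<omega>) * FZ z (X \<omega>)) \<partial>M)"
      by (subst prob_Int_eq_integral_cond_prob[OF X A]) (auto intro!: integral_cong_AE ae)
    also have "ennreal \<dots> = (\<integral>\<^sup>+\<omega>. indicator A (X \<omega>) * (FY y (X \<omega>) * FZ z (X \<omega>)) \<partial>M)"
    proof (rule nn_integral_eq_integral[symmetric])
      show "integrable M (\<lambda>\<omega>. indicator A (X \<omega>) * (FY y (X \<omega>) * FZ z (X \<omega>)))"
        using cdf01 measurable_space[OF X]
        by (intro integrable_const_bound[where B=1])
          (auto simp: indicator_def abs_mult intro!: mult_le_one)
    qed (use cdf01 measurable_space[OF X] in auto)
    also have "\<dots> = (\<integral>\<^sup>+\<omega>. emeasure (?K \<omega>) S \<partial>M)"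
    proof (rule nn_integral_cong)
      fix \<omega> assume "\<omega> \<in> space M"
      then have x: "X \<omega> \<in> space N" using X by (rule measurable_space[rotated])
      interpret b: prob_space "\<nu> (X \<omega>)"
        using measurable_space[OF \<nu> x] by (simp add: space_prob_algebra)
      have [measurable_cong, simp]: "sets (\<mu> (X \<omega>)) = sets borel" "sets (\<nu> (X \<omega>)) = sets borel"
        using measurable_space[OF \<mu> x] measurable_space[OF \<nu> x]
        by (simp_all add: space_prob_algebra)
      have spaces: "space (\<mu> (X \<omega>)) = UNIV" "space (\<nu> (X \<omega>)) = UNIV"
        by (simp_all cong: sets_eq_imp_space_eq)
      have "emeasure (?K \<omega>) S = emeasure (\<mu> (X \<omega>) \<Otimes>\<^sub>M \<nu> (X \<omega>)) 
          (Pair (X \<omega>) -` S \<inter> space (\<mu> (X \<omega>) \<Otimes>\<^sub>M \<nu> (X \<omega>)))"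
        using x unfolding S borel_prod[symmetric] by (intro emeasure_distr) measurable
      also have "Pair (X \<omega>) -` S \<inter> space (\<mu> (X \<omega>) \<Otimes>\<^sub>M \<nu> (X \<omega>)) 
          = (if X \<omega> \<in> A then {..y} \<times> {..z} else {})"
        by (auto simp: S space_pair_measure spaces)
      also have "emeasure (\<mu> (X \<omega>) \<Otimes>\<^sub>M \<nu> (X \<omega>)) \<dots>
         = ennreal (indicator A (X \<omega>) * (FY y (X \<omega>) * FZ z (X \<omega>)))"
        using cdf01[OF x] 
        by (simp add: b.emeasure_pair_measure_Times FY_\<mu>[OF x] FZ_\<nu>[OF x] ennreal_mult)
      finally show "ennreal (indicator A (X \<omega>) * (FY y (X \<omega>) * FZ z (X \<omega>)))
        = emeasure (?K \<omega>) S" ..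
    qed
    also have "\<dots> = emeasure (M \<bind> ?K) S"
      unfolding S using K
      by (intro emeasure_bind[symmetric, where N="N \<Otimes>\<^sub>M borel"])
        (auto simp: not_empty simp flip: borel_prod)
    finally show "emeasure ?L S = emeasure (M \<bind> ?K) S" .
  qed
qed

section \<open>Independence of the conditional probability transforms\<close>

lemma (in prob_space) indep_var_if_distr_pair_eq:
  assumes P: "prob_space P" and Q: "prob_space Q" and sets: "sets P = sets S" "sets Q = sets T"
    and UV: "U \<in> M \<rightarrow>\<^sub>M S" "V \<in> M \<rightarrow>\<^sub>M T"
    and law: "distr M (S \<Otimes>\<^sub>M T) (\<lambda>\<omega>. (U \<omega>, V \<omega>)) = P \<Otimes>\<^sub>M Q"
  shows "indep_var S U T V"
proof -
  interpret P: prob_space P by fact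
  interpret Q: prob_space Q by fact
  note [measurable] = UV
  have eq: "emeasure M {\<omega> \<in> space M. U \<omega> \<in> A \<and> V \<omega> \<in> B} = emeasure P A * emeasure Q B" 
    if "A \<in> sets S" "B \<in> sets T" for A B
  proof -
    have "emeasure P A * emeasure Q B = emeasure (P \<Otimes>\<^sub>M Q) (A \<times> B)"
      using that sets by (simp add: Q.emeasure_pair_measure_Times)
    also have "\<dots> = emeasure M {\<omega> \<in> space M. U \<omega> \<in> A \<and> V \<omega> \<in> B}"
      using that unfolding law[symmetric]
      by (subst emeasure_distr) (auto intro!: arg_cong[where f="emeasure M"])
    finally show ?thesis ..
  qed
  have "distr M S U = P"
  proof (rule measure_eqI)
    fix A assume "A \<in> sets (distr M S U)"
    then show "emeasure (distr M S U) A = emeasure P A"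
      using eq[of A "space T"] sets_eq_imp_space_eq[OF sets(2)] Q.emeasure_space_1
        measurable_space[OF UV(2)]
      by (simp add: emeasure_distr vimage_def Int_def conj_commute cong: conj_cong)
  qed (simp add: sets)
  moreover have "distr M T V = Q"
  proof (rule measure_eqI)
    fix B assume "B \<in> sets (distr M T V)"
    then show "emeasure (distr M T V) B = emeasure Q B"
      using eq[of "space S" B] sets_eq_imp_space_eq[OF sets(1)] P.emeasure_space_1
        measurable_space[OF UV(1)]
      by (simp add: emeasure_distr vimage_def Int_def conj_commute cong: conj_cong)
  qed (simp add: sets)
  ultimately show ?thesis
    using UV law by (simp add: indep_var_distribution_eq)
qed

text \<open>
  The definition of a conditional distribution function gives measurability in \<open>x\<close> for each fixed \<open>y\<close>
  only; joint measurability, which makes \<open>U\<close> and \<open>V\<close> random variables, comes from the kernel.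
\<close>

lemma measurable_cdf_kernel:
  assumes "\<mu> \<in> N \<rightarrow>\<^sub>M prob_algebra borel"
  shows "(\<lambda>(x, y). cdf (\<mu> x) y) \<in> borel_measurable (N \<Otimes>\<^sub>M borel)"
proof -
  have [measurable]: "\<mu> \<in> N \<rightarrow>\<^sub>M subprob_algebra borel"
    using assms by (rule measurable_prob_algebraD)
  have "(\<lambda>p. measure (\<mu> (fst p)) {..snd p}) \<in> borel_measurable (N \<Otimes>\<^sub>M borel)"
  proof (rule measure_measurable_subprob_algebra2[where N=borel])
    have "(SIGMA p:space (N \<Otimes>\<^sub>M borel). {..snd p :: real}) =
      {q \<in> space ((N \<Otimes>\<^sub>M borel) \<Otimes>\<^sub>M borel). snd q \<le> snd (fst q)}"
      by (auto simp: space_pair_measure)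
    also have "\<dots> \<in> sets ((N \<Otimes>\<^sub>M borel) \<Otimes>\<^sub>M borel)"
      by measurable
    finally show "(SIGMA p:space (N \<Otimes>\<^sub>M borel). {..snd p :: real}) \<in> sets ((N \<Otimes>\<^sub>M borel) \<Otimes>\<^sub>M borel)" .
  qed measurable
  then show ?thesis
    by (simp add: cdf_def split_beta')
qed

theorem mainTheorem2:
  fixes M :: "'a measure" and N :: "'x measure"
    and X :: "'a \<Rightarrow> 'x" and Y Z U V :: "'a \<Rightarrow> real"
    and FY FZ :: "real \<Rightarrow> 'x \<Rightarrow> real"
  assumes "prob_space M"
    and "X \<in> measurable M N"
    and "Y \<in> borel_measurable M"
    and "Z \<in> borel_measurable M"
    and "cond_cdf M N X Y FY"
    and "cond_cdf M N X Z FZ"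
    and "\<And>x. x \<in> space N \<Longrightarrow> continuous_on UNIV (\<lambda>y. FY y x)"
    and "\<And>x. x \<in> space N \<Longrightarrow> continuous_on UNIV (\<lambda>z. FZ z x)"
    and "U = (\<lambda>\<omega>. FY (Y \<omega>) (X \<omega>))"
    and "V = (\<lambda>\<omega>. FZ (Z \<omega>) (X \<omega>))"
    and "cond_indep_var M N X borel Y borel Z"
  shows "prob_space.indep_var M borel U borel V"
proof -
  interpret prob_space M by fact
  note [measurable] = assms(2-4)
  obtain \<mu> where \<mu>[measurable]: "\<mu> \<in> N \<rightarrow>\<^sub>M prob_algebra borel"
    and \<mu>_rd: "\<And>x. x \<in> space N \<Longrightarrow> real_distribution (\<mu> x)"
    and FY: "\<And>x y. x \<in> space N \<Longrightarrow> FY y x = cdf (\<mu> x) y"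
    using cond_cdf_kernelE[OF assms(5)] by blast
  obtain \<nu> where \<nu>[measurable]: "\<nu> \<in> N \<rightarrow>\<^sub>M prob_algebra borel"
    and \<nu>_rd: "\<And>x. x \<in> space N \<Longrightarrow> real_distribution (\<nu> x)"
    and FZ: "\<And>x y. x \<in> space N \<Longrightarrow> FZ y x = cdf (\<nu> x) y"
    using cond_cdf_kernelE[OF assms(6)] by blast
  note [measurable] = measurable_cdf_kernel[OF \<mu>] measurable_cdf_kernel[OF \<nu>]
  have [measurable]: "\<mu> \<in> N \<rightarrow>\<^sub>M subprob_algebra borel" "\<nu> \<in> N \<rightarrow>\<^sub>M subprob_algebra borel"
    using \<mu> \<nu> by (auto intro: measurable_prob_algebraD)
  define h where "h = (\<lambda>(x, y, z). (cdf (\<mu> x) y, cdf (\<nu> x) z))"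
  have h[measurable]: "h \<in> N \<Otimes>\<^sub>M borel \<rightarrow>\<^sub>M borel \<Otimes>\<^sub>M borel"
    unfolding h_def borel_prod[symmetric] by measurable
  let ?I = "uniform_measure lborel {0..1::real}"
  have I: "prob_space ?I"
    by (rule prob_space_uniform_measure) auto
  let ?K = "\<lambda>\<omega>. distr (\<mu> (X \<omega>) \<Otimes>\<^sub>M \<nu> (X \<omega>)) (N \<Otimes>\<^sub>M borel) (Pair (X \<omega>))"
  have K: "?K \<in> M \<rightarrow>\<^sub>M subprob_algebra (N \<Otimes>\<^sub>M borel)"
    by (rule measurable_product_kernel) measurable
  have uniform: "distr (?K \<omega>) (borel \<Otimes>\<^sub>M borel) h = ?I \<Otimes>\<^sub>M ?I" if "\<omega> \<in> space M" for \<omega>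
  proof -
    have x: "X \<omega> \<in> space N" using that by (rule measurable_space[OF assms(2)])
    interpret a: real_distribution "\<mu> (X \<omega>)" using \<mu>_rd[OF x] .
    interpret b: real_distribution "\<nu> (X \<omega>)" using \<nu>_rd[OF x] .
    have a: "distr (\<mu> (X \<omega>)) borel (cdf (\<mu> (X \<omega>))) = ?I"
      using assms(7)[OF x] FY[OF x] by (intro a.distr_cdf_eq_uniform) simp
    have b: "distr (\<nu> (X \<omega>)) borel (cdf (\<nu> (X \<omega>))) = ?I"
      using assms(8)[OF x] FZ[OF x] by (intro b.distr_cdf_eq_uniform) simp
    have [measurable]: "cdf (\<mu> (X \<omega>)) \<in> borel_measurable borel"
      "cdf (\<nu> (X \<omega>)) \<in> borel_measurable borel"
      by (auto intro!: borel_measurable_mono simp: mono_def a.cdf_nondecreasing b.cdf_nondecreasing)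
    have "distr (?K \<omega>) (borel \<Otimes>\<^sub>M borel) h = 
      distr (\<mu> (X \<omega>) \<Otimes>\<^sub>M \<nu> (X \<omega>)) (borel \<Otimes>\<^sub>M borel) (h \<circ> Pair (X \<omega>))"
      using x by (intro distr_distr h) (simp flip: borel_prod)
    also have "h \<circ> Pair (X \<omega>) = (\<lambda>(y, z). (cdf (\<mu> (X \<omega>)) y, cdf (\<nu> (X \<omega>)) z))"
      by (auto simp: h_def fun_eq_iff)
    also have "distr (\<mu> (X \<omega>) \<Otimes>\<^sub>M \<nu> (X \<omega>)) (borel \<Otimes>\<^sub>M borel) \<dots> = ?I \<Otimes>\<^sub>M ?I"
      using pair_measure_distr[of "cdf (\<mu> (X \<omega>))" "\<mu> (X \<omega>)" borel "cdf (\<nu> (X \<omega>))" "\<nu> (X \<omega>)" borel]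
        prob_space_imp_sigma_finite[OF I]
      unfolding a b by simp
    finally show ?thesis .
  qed
  have UV: "U \<omega> = cdf (\<mu> (X \<omega>)) (Y \<omega>)" "V \<omega> = cdf (\<nu> (X \<omega>)) (Z \<omega>)" if "\<omega> \<in> space M" for \<omega>
    using measurable_space[OF assms(2) that] by (simp_all add: assms(9,10) FY FZ)
  have "(\<lambda>\<omega>. cdf (\<mu> (X \<omega>)) (Y \<omega>)) \<in> borel_measurable M"
    "(\<lambda>\<omega>. cdf (\<nu> (X \<omega>)) (Z \<omega>)) \<in> borel_measurable M"
    by measurable
  then have meas: "U \<in> borel_measurable M" "V \<in> borel_measurable M"
    by (simp_all add: UV cong: measurable_cong)
  have "distr M (borel \<Otimes>\<^sub>M borel) (\<lambda>\<omega>. (U \<omega>, V \<omega>))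
      = distr M (borel \<Otimes>\<^sub>M borel) (h \<circ> (\<lambda>\<omega>. (X \<omega>, (Y \<omega>, Z \<omega>))))"
    by (intro distr_cong) (auto simp: UV h_def)
  also have "\<dots> = distr (distr M (N \<Otimes>\<^sub>M borel) (\<lambda>\<omega>. (X \<omega>, (Y \<omega>, Z \<omega>)))) (borel \<Otimes>\<^sub>M borel) h"
    by (intro distr_distr[symmetric] h) (simp flip: borel_prod)
  also have "\<dots> = distr (M \<bind> ?K) (borel \<Otimes>\<^sub>M borel) h"
    by (subst joint_law_eq_bind[OF assms(2-6,11) \<mu> FY \<nu> FZ]) auto
  also have "\<dots> = M \<bind> (\<lambda>\<omega>. distr (?K \<omega>) (borel \<Otimes>\<^sub>M borel) h)"
    by (rule distr_bind[OF K not_empty h])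
  also have "\<dots> = M \<bind> (\<lambda>\<omega>. ?I \<Otimes>\<^sub>M ?I)"
    by (intro bind_cong uniform refl)
  also have "\<dots> = ?I \<Otimes>\<^sub>M ?I"
    using I by (intro bind_const' prob_space_imp_subprob_space prob_space_pair prob_space_axioms)
  finally show ?thesis
    using I meas by (intro indep_var_if_distr_pair_eq[where P="?I" and Q="?I"]) auto
qed

end
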